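(* Let $k\ge 1$ and let $G_1=(V,E_1),\ldots,G_k=(V,E_k)$ be planar graphs with shared vertex set $V$ in the sunflower setting, i.e., every edge in $E_1\cup\cdots\cup E_k$ belongs either to exactly one of $E_1,\ldots,E_k$ or to all of them. Then $\langle G_1,\ldots,G_k\rangle$ admits a QuaSEFE.
   Context: Drawings are topological: vertices are distinct points of the plane and edges are curves joining their endpoints. A drawing is quasiplanar if no three of its edges pairwise cross. Given graphs $G_1=(V,E_1),\ldots,G_k=(V,E_k)$ on a shared vertex set $V$, the tuple $\langle G_1,\ldots,G_k\rangle$ admits a QuaSEFE if there are quasiplanar drawings $\Gamma_1,\ldots,\Gamma_k$ of $G_1,\ldots,G_k$ such that each vertex of $V$ has the same position in every $\Gamma_i$ and each edge shared by $G_i$ and $G_j$ is drawn as the same curve in $\Gamma_i$ and $\Gamma_j$. *)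

theory Defs
  imports "HOL-Analysis.Analysis"
begin

definition simple_graph :: "'v set \<Rightarrow> 'v set set \<Rightarrow> bool" where
  "simple_graph V E \<longleftrightarrow> finite V \<and> (\<forall>e\<in>E. e \<subseteq> V \<and> card e = 2)"

text \<open>The fields are meaningful only on the vertices and edges of the drawn graph. The
  parametrization and the orientation of an edge's path are immaterial: all notions below
  depend only on its image and on its set of endpoints.\<close>

record 'v drawing =
  vpos :: "'v \<Rightarrow> real ^ 2"
  curve :: "'v set \<Rightarrow> real \<Rightarrow> real ^ 2"

text \<open>Edges are simple curves and, as usual, do not pass through vertices other than their
  endpoints. No finiteness or transversality of the intersections is imposed.\<close>

definition drawing_of :: "'v set \<Rightarrow> 'v set set \<Rightarrow> 'v drawing \<Rightarrow> bool" where
  "drawing_of V E \<Gamma> \<longleftrightarrow>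
     inj_on (vpos \<Gamma>) V \<and>
     (\<forall>e\<in>E. arc (curve \<Gamma> e) \<and>
        {pathstart (curve \<Gamma> e), pathfinish (curve \<Gamma> e)} = vpos \<Gamma> ` e \<and>
        path_image (curve \<Gamma> e) \<inter> vpos \<Gamma> ` V = vpos \<Gamma> ` e)"

text \<open>Any common point interior to both curves counts as a crossing, so touchings and
  overlaps are crossings too; a common endpoint is not.\<close>

definition cross :: "(real \<Rightarrow> real ^ 2) \<Rightarrow> (real \<Rightarrow> real ^ 2) \<Rightarrow> bool" where
  "cross g h \<longleftrightarrow>
     (path_image g - {pathstart g, pathfinish g}) \<inter>
     (path_image h - {pathstart h, pathfinish h}) \<noteq> {}"

definition planar_drawing :: "'v set \<Rightarrow> 'v set set \<Rightarrow> 'v drawing \<Rightarrow> bool" where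
  "planar_drawing V E \<Gamma> \<longleftrightarrow>
     drawing_of V E \<Gamma> \<and>
     (\<forall>e\<in>E. \<forall>f\<in>E. e \<noteq> f \<longrightarrow> \<not> cross (curve \<Gamma> e) (curve \<Gamma> f))"

definition planar_graph :: "'v set \<Rightarrow> 'v set set \<Rightarrow> bool" where
  "planar_graph V E \<longleftrightarrow> simple_graph V E \<and> (\<exists>\<Gamma>. planar_drawing V E \<Gamma>)"

definition quasiplanar_drawing :: "'v set \<Rightarrow> 'v set set \<Rightarrow> 'v drawing \<Rightarrow> bool" where
  "quasiplanar_drawing V E \<Gamma> \<longleftrightarrow>
     drawing_of V E \<Gamma> \<and>
     \<not> (\<exists>e\<in>E. \<exists>f\<in>E. \<exists>g\<in>E. e \<noteq> f \<and> e \<noteq> g \<and> f \<noteq> g \<and>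
          cross (curve \<Gamma> e) (curve \<Gamma> f) \<and>
          cross (curve \<Gamma> e) (curve \<Gamma> g) \<and>
          cross (curve \<Gamma> f) (curve \<Gamma> g))"

definition sunflower :: "nat \<Rightarrow> (nat \<Rightarrow> 'v set set) \<Rightarrow> bool" where
  "sunflower k E \<longleftrightarrow>
     (\<forall>e \<in> (\<Union>i\<in>{1..k}. E i).
        (\<exists>!i. i \<in> {1..k} \<and> e \<in> E i) \<or> (\<forall>i\<in>{1..k}. e \<in> E i))"

definition admits_QuaSEFE :: "'v set \<Rightarrow> nat \<Rightarrow> (nat \<Rightarrow> 'v set set) \<Rightarrow> bool" where
  "admits_QuaSEFE V k E \<longleftrightarrow>
     (\<exists>\<Gamma> :: nat \<Rightarrow> 'v drawing.
        (\<forall>i\<in>{1..k}. quasiplanar_drawing V (E i) (\<Gamma> i)) \<and>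
        (\<forall>i\<in>{1..k}. \<forall>j\<in>{1..k}. \<forall>v\<in>V. vpos (\<Gamma> i) v = vpos (\<Gamma> j) v) \<and>
        (\<forall>i\<in>{1..k}. \<forall>j\<in>{1..k}. \<forall>e \<in> E i \<inter> E j.
           path_image (curve (\<Gamma> i) e) = path_image (curve (\<Gamma> j) e)))"

end

theory Submission
  imports Defs
begin

text \<open>Draw the edges common to all graphs as in a planar drawing of the first graph, and draw the
  private edges of each graph as in a planar drawing of that graph, moved by a homeomorphism of
  the plane that takes its vertices to the prescribed positions. Among three edges of one graph,
  two are of the same kind, and these do not cross.\<close>

lemma planar_drawing_subset:
  assumes "planar_drawing V E \<Gamma>" "F \<subseteq> E"
  shows "planar_drawing V F \<Gamma>"
  using assms by (simp add: planar_drawing_def drawing_of_def subset_iff)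

text \<open>Injectivity makes \<open>f\<close> commute with intersections, so an image curve meets
  no vertices beyond its endpoints. Arcs stay arcs because \<open>f\<close> is continuous and
  injective.\<close>

lemma drawing_of_inj_image:
  assumes "drawing_of V E \<Gamma>" "continuous_on UNIV f" "inj f"
  shows "drawing_of V E \<lparr>vpos = f \<circ> vpos \<Gamma>, curve = \<lambda>e. f \<circ> curve \<Gamma> e\<rparr>"
proof -
  have "inj_on (f \<circ> vpos \<Gamma>) V"
    using assms unfolding drawing_of_def by (metis comp_inj_on inj_on_subset subset_UNIV)
  moreover have "arc (f \<circ> curve \<Gamma> e) \<and>
        {pathstart (f \<circ> curve \<Gamma> e), pathfinish (f \<circ> curve \<Gamma> e)} = (f \<circ> vpos \<Gamma>) ` e \<and>
        path_image (f \<circ> curve \<Gamma> e) \<inter> (f \<circ> vpos \<Gamma>) ` V = (f \<circ> vpos \<Gamma>) ` e" if "e \<in> E" for e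
  proof -
    have e: "arc (curve \<Gamma> e)" "{pathstart (curve \<Gamma> e), pathfinish (curve \<Gamma> e)} = vpos \<Gamma> ` e"
      "path_image (curve \<Gamma> e) \<inter> vpos \<Gamma> ` V = vpos \<Gamma> ` e"
      using assms(1) that by (auto simp: drawing_of_def)
    have "arc (f \<circ> curve \<Gamma> e)"
      using e(1) assms(2,3) unfolding arc_def
      by (metis comp_inj_on continuous_on_subset inj_on_subset path_continuous_image subset_UNIV)
    moreover have "{pathstart (f \<circ> curve \<Gamma> e), pathfinish (f \<circ> curve \<Gamma> e)} = (f \<circ> vpos \<Gamma>) ` e"
      using arg_cong[OF e(2), of "image f"] by (simp add: pathstart_compose pathfinish_compose image_comp)
    moreover have "path_image (f \<circ> curve \<Gamma> e) \<inter> (f \<circ> vpos \<Gamma>) ` V = (f \<circ> vpos \<Gamma>) ` e"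
      using arg_cong[OF e(3), of "image f"] assms(3)
      by (simp add: image_Int path_image_compose image_comp)
    ultimately show ?thesis by simp
  qed
  ultimately show ?thesis
    by (simp add: drawing_of_def)
qed

lemma cross_inj_image:
  assumes "inj f"
  shows "cross (f \<circ> g) (f \<circ> h) \<longleftrightarrow> cross g h"
proof -
  have "path_image (f \<circ> p) - {pathstart (f \<circ> p), pathfinish (f \<circ> p)} =
      f ` (path_image p - {pathstart p, pathfinish p})" for p
    using assms by (simp add: image_set_diff path_image_compose pathstart_compose pathfinish_compose)
  then show ?thesis
    using assms by (simp add: cross_def flip: image_Int)
qed

lemma planar_drawing_inj_image:
  assumes "planar_drawing V E \<Gamma>" "continuous_on UNIV f" "inj f"
  shows "planar_drawing V E \<lparr>vpos = f \<circ> vpos \<Gamma>, curve = \<lambda>e. f \<circ> curve \<Gamma> e\<rparr>"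
  using assms by (simp add: planar_drawing_def drawing_of_inj_image cross_inj_image)

text \<open>In a connected open set of dimension at least 2, here the whole plane, some
  homeomorphism moves finitely many distinct points to any prescribed distinct points. Applied to
  the vertices, it carries the entire planar drawing along.\<close>

lemma planar_drawing_prescribed_positions:
  assumes "planar_graph V E" "inj_on p V"
  obtains \<Gamma> where "planar_drawing V E \<Gamma>" "\<And>v. v \<in> V \<Longrightarrow> vpos \<Gamma> v = p v"
proof -
  obtain \<Delta> where \<Delta>: "planar_drawing V E \<Delta>" and fin: "finite V"
    using assms(1) by (auto simp: planar_graph_def simple_graph_def)
  have "inj_on (vpos \<Delta>) V"
    using \<Delta> by (simp add: planar_drawing_def drawing_of_def)
  \<comment> \<open>Sources and targets of the motion must both be distinct: this comes from the
    drawing for \<open>vpos \<Delta>\<close> and from the assumption for \<open>p\<close>.\<close>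
  then have "pairwise (\<lambda>v w. vpos \<Delta> v \<noteq> vpos \<Delta> w \<and> p v \<noteq> p w) V"
    using assms(2) by (auto simp: pairwise_def inj_on_def)
  then obtain f g where fg: "homeomorphism UNIV UNIV f g"
    and f: "\<And>v. v \<in> V \<Longrightarrow> f (vpos \<Delta> v) = p v"
    using homeomorphism_moving_points_exists[of UNIV UNIV V "vpos \<Delta>" p] fin
    by (simp add: connected_UNIV) metis
  have "continuous_on UNIV f" "inj f"
    using fg by (auto simp: homeomorphism_def intro: inj_on_inverseI)
  then show thesis
    using that planar_drawing_inj_image[OF \<Delta>] f by fastforce
qed

text \<open>\<open>E\<close> and \<open>F\<close> may overlap; an edge in both takes its curve from
  \<open>\<Gamma>\<close>. Membership in \<open>E\<close> thus splits the edges into two classes,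
  each drawn without crossings.\<close>

lemma quasiplanar_drawing_union:
  assumes \<Gamma>: "planar_drawing V E \<Gamma>" and \<Delta>: "planar_drawing V F \<Delta>"
    and pos: "\<And>v. v \<in> V \<Longrightarrow> vpos \<Delta> v = vpos \<Gamma> v"
    and sub: "\<And>e. e \<in> F \<Longrightarrow> e \<subseteq> V"
  shows "quasiplanar_drawing V (E \<union> F)
    \<lparr>vpos = vpos \<Gamma>, curve = \<lambda>e. if e \<in> E then curve \<Gamma> e else curve \<Delta> e\<rparr>"
    (is "quasiplanar_drawing V _ ?\<Theta>")
proof -
  \<comment> \<open>Used for \<open>V\<close> and for each edge of \<open>F\<close>, this turns the
    incidence conditions on the curves of \<open>\<Delta>\<close> into conditions on the common
    positions.\<close>
  have "vpos \<Delta> ` A = vpos \<Gamma> ` A" if "A \<subseteq> V" for A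
    using pos that by (intro image_cong) auto
  then have drawing: "drawing_of V (E \<union> F) ?\<Theta>"
    using \<Gamma> \<Delta> sub by (simp add: planar_drawing_def drawing_of_def ball_Un)
  have no_cross: "\<not> cross (curve ?\<Theta> e) (curve ?\<Theta> f)"
    if "e \<in> E \<union> F" "f \<in> E \<union> F" "e \<noteq> f" "e \<in> E \<longleftrightarrow> f \<in> E" for e f
    using \<Gamma> \<Delta> that by (auto simp: planar_drawing_def)
  have no_triple: False
    if "e \<in> E \<union> F" "f \<in> E \<union> F" "g \<in> E \<union> F" "e \<noteq> f" "e \<noteq> g" "f \<noteq> g"
      "cross (curve ?\<Theta> e) (curve ?\<Theta> f)" "cross (curve ?\<Theta> e) (curve ?\<Theta> g)"
      "cross (curve ?\<Theta> f) (curve ?\<Theta> g)" for e f g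
    \<comment> \<open>Pigeonhole: two of the three edges agree on membership in \<open>E\<close>, so
      they cannot cross.\<close>
    using no_cross[of e f] no_cross[of e g] no_cross[of f g] that by argo
  show ?thesis
    unfolding quasiplanar_drawing_def using drawing no_triple by meson
qed

theorem theorem5:
  fixes V :: "'v set" and k :: nat and E :: "nat \<Rightarrow> 'v set set"
  assumes "k \<ge> 1"
    and "\<And>i. i \<in> {1..k} \<Longrightarrow> planar_graph V (E i)"
    and "sunflower k E"
  shows "admits_QuaSEFE V k E"
proof -
  define S where "S = (\<Inter>i\<in>{1..k}. E i)"
  have "planar_graph V (E 1)"
    using assms(1,2) by simp
  then obtain \<Gamma> where "planar_drawing V (E 1) \<Gamma>"
    by (auto simp: planar_graph_def)
  moreover have "S \<subseteq> E 1"
    using assms(1) by (auto simp: S_def)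
  ultimately have \<Gamma>: "planar_drawing V S \<Gamma>"
    by (rule planar_drawing_subset)
  then have "inj_on (vpos \<Gamma>) V"
    by (simp add: planar_drawing_def drawing_of_def)
  \<comment> \<open>Each graph is redrawn in full, shared edges included; below, only the curves of
    its edges outside \<open>S\<close> are kept.\<close>
  then have "\<forall>i\<in>{1..k}. \<exists>\<Delta>. planar_drawing V (E i) \<Delta> \<and> (\<forall>v\<in>V. vpos \<Delta> v = vpos \<Gamma> v)"
    using assms(2) by (metis planar_drawing_prescribed_positions)
  then obtain \<Delta> where \<Delta>: "\<And>i. i \<in> {1..k} \<Longrightarrow> planar_drawing V (E i) (\<Delta> i)"
    and pos: "\<And>i v. i \<in> {1..k} \<Longrightarrow> v \<in> V \<Longrightarrow> vpos (\<Delta> i) v = vpos \<Gamma> v"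
    by metis
  define \<Theta> where
    "\<Theta> i = \<lparr>vpos = vpos \<Gamma>, curve = \<lambda>e. if e \<in> S then curve \<Gamma> e else curve (\<Delta> i) e\<rparr>" for i
  have "quasiplanar_drawing V (E i) (\<Theta> i)" if i: "i \<in> {1..k}" for i
  proof -
    \<comment> \<open>The union lemma is applied with the overlapping sets \<open>S\<close> and
      \<open>E i\<close>, so its case distinction is literally the one in
      \<open>\<Theta> i\<close>.\<close>
    have "S \<union> E i = E i"
      using i by (auto simp: S_def)
    moreover have "e \<subseteq> V" if "e \<in> E i" for e
      using assms(2)[OF i] that by (simp add: planar_graph_def simple_graph_def)
    ultimately show ?thesis
      using quasiplanar_drawing_union[OF \<Gamma> \<Delta>[OF i]] pos[OF i] by (simp add: \<Theta>_def)
  qed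
  moreover have "vpos (\<Theta> i) v = vpos (\<Theta> j) v" for i j v
    by (simp add: \<Theta>_def)
  moreover have "curve (\<Theta> i) e = curve (\<Theta> j) e"
    if "i \<in> {1..k}" "j \<in> {1..k}" "e \<in> E i \<inter> E j" for i j e
  proof (cases "i = j")
    case False
    \<comment> \<open>Lying in two different edge sets excludes the uniqueness alternative of
      \<open>sunflower\<close>. Hence \<open>e\<close> is in \<open>S\<close>, where the curve does
      not depend on the index.\<close>
    then have "\<forall>i\<in>{1..k}. e \<in> E i"
      using assms(3) that unfolding sunflower_def by blast
    then show ?thesis
      by (simp add: \<Theta>_def S_def)
  qed simp
  ultimately show ?thesis
    unfolding admits_QuaSEFE_def by (intro exI[of _ \<Theta>] conjI ballI) metis+
qed

end
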